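(* Let $I$ be a metric interval of length $L>0$, let $r>0$, and let $\nu$ be a probability measure on $\mathcal C(I)$ such that $E_\nu\le\frac{L}{r}\,U[0,r]$. Then the following statements hold. (i) The measure inequality is an equality: $E_\nu=\frac{L}{r}\,U[0,r]$. (ii) For $\nu$-almost every cover $(r_1,\dots,r_m)$, all radii are positive and $\sum_{i=1}^m r_i=L/2$. (iii) For $\nu$-almost every radius tuple satisfying (ii), every choice of centers $v_1,\dots,v_m\in I$ that realizes the tuple (i.e. $I\subseteq\bigcup_i B_I(v_i,r_i)$) gives intervals $B_I(v_i,r_i)$ with pairwise disjoint interiors; each interval $B_I(v_i,r_i)$ has length $2r_i$, and their union is $I$.
   Context: A metric interval of length $L$ is a metric tree isometric to $[0,L]$, with metric $d_I$ and closed balls $B_I(v,s)=\{x\in I:d_I(x,v)\le s\}$. For $m\ge1$, a tuple $\mathbf r=(r_1,\dots,r_m)\in\mathbb R_{\ge0}^m$ is a cover of $I$ if there are $v_1,\dots,v_m\in I$ with $I\subseteq\bigcup_i B_I(v_i,r_i)$; $\mathcal C_m(I)$ is the set of such tuples and $\mathcal C(I)=\bigsqcup_{m\ge1}\mathcal C_m(I)$ with the disjoint-union Borel structure. For a finite Borel measure $\nu$ on $\mathcal C(I)$, the expected radius measure is $E_\nu(A)=\int|\{i:r_i\in A\}|\,d\nu(\mathbf r)$ for Borel $A\subseteq\mathbb R_{\ge0}$. For positive Borel measures, $\mu\le\mu'$ means $\mu(A)\le\mu'(A)$ for all Borel $A$. $U[0,r]$ is the uniform probability measure on $[0,r]$,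 viewed as a measure on $\mathbb R_{\ge0}$. *)

theory Defs
  imports "HOL-Probability.Probability"
begin

text \<open>
  A metric space isometric to \<open>[0, L]\<close> is automatically a metric tree, so that property is not
  listed separately.
\<close>

definition metric_interval :: "'a set \<Rightarrow> ('a \<Rightarrow> 'a \<Rightarrow> real) \<Rightarrow> real \<Rightarrow> bool" where
  "metric_interval I d L \<longleftrightarrow> Metric_space I d \<and> 0 \<le> L \<and>
     (\<exists>f. f ` {0..L} = I \<and> (\<forall>s\<in>{0..L}. \<forall>t\<in>{0..L}. d (f s) (f t) = \<bar>s - t\<bar>))"

definition realizes_cover ::
  "'a set \<Rightarrow> ('a \<Rightarrow> 'a \<Rightarrow> real) \<Rightarrow> nat \<Rightarrow> (nat \<Rightarrow> 'a) \<Rightarrow> (nat \<Rightarrow> real) \<Rightarrow> bool" where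
  "realizes_cover I d m v \<rho> \<longleftrightarrow>
     (\<forall>i\<in>{1..m}. v i \<in> I) \<and> I \<subseteq> (\<Union>i\<in>{1..m}. Metric_space.mcball I d (v i) (\<rho> i))"

text \<open>
  Tuples \<open>(r\<^sub>1, \<dots>, r\<^sub>m)\<close> are functions on \<open>{1..m}\<close>, extensional so that each tuple is represented
  exactly once.
\<close>

definition covers :: "'a set \<Rightarrow> ('a \<Rightarrow> 'a \<Rightarrow> real) \<Rightarrow> nat \<Rightarrow> (nat \<Rightarrow> real) set" where
  "covers I d m = {\<rho> \<in> {1..m} \<rightarrow>\<^sub>E {0..}. \<exists>v. realizes_cover I d m v \<rho>}"

text \<open>
  The Borel structure on \<open>covers I d m\<close> is the trace of the Borel sets of \<open>\<real>\<^sup>m\<close>, which form the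
  product sigma-algebra. On the disjoint union, a set is Borel iff each of its slices is.
\<close>

definition covers_borel :: "'a set \<Rightarrow> ('a \<Rightarrow> 'a \<Rightarrow> real) \<Rightarrow> nat \<Rightarrow> (nat \<Rightarrow> real) measure" where
  "covers_borel I d m = restrict_space (Pi\<^sub>M {1..m} (\<lambda>_. borel)) (covers I d m)"

definition all_covers :: "'a set \<Rightarrow> ('a \<Rightarrow> 'a \<Rightarrow> real) \<Rightarrow> (nat \<times> (nat \<Rightarrow> real)) set" where
  "all_covers I d = (SIGMA m:{1..}. covers I d m)"

definition all_covers_borel ::
  "'a set \<Rightarrow> ('a \<Rightarrow> 'a \<Rightarrow> real) \<Rightarrow> (nat \<times> (nat \<Rightarrow> real)) measure" where
  "all_covers_borel I d = sigma (all_covers I d)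
     {A. A \<subseteq> all_covers I d \<and> (\<forall>m\<ge>1. Pair m -` A \<in> sets (covers_borel I d m))}"

definition expected_radius_measure :: "(nat \<times> (nat \<Rightarrow> real)) measure \<Rightarrow> real measure" where
  "expected_radius_measure \<nu> = measure_of {0..} (sets (restrict_space borel {0..}))
     (\<lambda>A. \<integral>\<^sup>+(m, \<rho>). of_nat (card {i\<in>{1..m}. \<rho> i \<in> A}) \<partial>\<nu>)"

definition uniform_radius_measure :: "real \<Rightarrow> real measure" where
  "uniform_radius_measure r = restrict_space (uniform_measure lborel {0..r}) {0..}"

lemma space_covers_borel: "space (covers_borel I d m) = covers I d m"
  by (auto simp: covers_borel_def space_restrict_space space_PiM covers_def)

lemma space_all_covers_borel: "space (all_covers_borel I d) = all_covers I d"
  unfolding all_covers_borel_def by (rule space_measure_of) auto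

lemma sets_all_covers_borel:
  "sets (all_covers_borel I d) =
     {A. A \<subseteq> all_covers I d \<and> (\<forall>m\<ge>1. Pair m -` A \<in> sets (covers_borel I d m))}"
proof -
  let ?S = "{A. A \<subseteq> all_covers I d \<and> (\<forall>m\<ge>1. Pair m -` A \<in> sets (covers_borel I d m))}"
  have "sigma_algebra (all_covers I d) ?S"
    unfolding sigma_algebra_iff2
  proof (intro conjI ballI allI impI)
    fix A assume A: "A \<in> ?S"
    have "Pair m -` (all_covers I d - A) \<in> sets (covers_borel I d m)" if "m \<ge> 1" for m
    proof -
      have "Pair m -` (all_covers I d - A) = space (covers_borel I d m) - Pair m -` A"
        using that by (auto simp: all_covers_def space_covers_borel)
      with A that show ?thesis by auto
    qed
    then show "all_covers I d - A \<in> ?S" by auto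
  next
    fix A :: "nat \<Rightarrow> (nat \<times> (nat \<Rightarrow> real)) set" assume "range A \<subseteq> ?S"
    then have "\<And>i. A i \<in> ?S" by blast
    then show "(\<Union>i. A i) \<in> ?S" by (auto simp: vimage_UN intro!: sets.countable_UN'')
  qed auto
  then show ?thesis
    unfolding all_covers_borel_def by (rule sigma_algebra.sets_measure_of_eq)
qed

lemma measurable_radius_count:
  assumes A: "A \<in> sets (borel :: real measure)"
  shows "(\<lambda>(m, \<rho>). of_nat (card {i\<in>{1..m}. \<rho> i \<in> A}) :: ennreal)
           \<in> borel_measurable (all_covers_borel I d)"
proof (rule measurableI)
  fix B :: "ennreal set" assume B: "B \<in> sets borel"
  define g where "g = (\<lambda>(m::nat, \<rho>::nat \<Rightarrow> real). of_nat (card {i\<in>{1..m}. \<rho> i \<in> A}) :: ennreal)"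
  have "Pair m -` (g -` B \<inter> all_covers I d) \<in> sets (covers_borel I d m)" if "m \<ge> 1" for m
  proof -
    have eq: "of_nat (card {i\<in>{1..m}. \<rho> i \<in> A}) = (\<Sum>i\<in>{1..m}. indicator A (\<rho> i) :: ennreal)"
      for \<rho> :: "nat \<Rightarrow> real"
      by (simp add: indicator_def sum.If_cases Int_def)
    have "(\<lambda>\<rho>. g (m, \<rho>)) \<in> borel_measurable (covers_borel I d m)"
      unfolding covers_borel_def g_def prod.case eq
      by (intro measurable_restrict_space1 borel_measurable_sum)
        (use A in measurable)
    from measurable_sets[OF this B] show ?thesis
      using that by (auto simp: space_covers_borel all_covers_def vimage_def Int_def)
  qed
  then show "(\<lambda>(m, \<rho>). of_nat (card {i\<in>{1..m}. \<rho> i \<in> A}) :: ennreal) -` B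
      \<inter> space (all_covers_borel I d) \<in> sets (all_covers_borel I d)"
    by (auto simp: sets_all_covers_borel space_all_covers_borel g_def)
qed simp

lemma space_expected_radius_measure: "space (expected_radius_measure \<nu>) = {0..}"
  and sets_expected_radius_measure:
    "sets (expected_radius_measure \<nu>) = sets (restrict_space borel {0..})"
proof -
  have sub: "sets (restrict_space borel {0..}) \<subseteq> Pow {0::real..}"
    using sets.space_closed[of "restrict_space borel {0::real..}"] by (simp add: space_restrict_space)
  show "space (expected_radius_measure \<nu>) = {0..}"
    unfolding expected_radius_measure_def using sub by (rule space_measure_of)
  show "sets (expected_radius_measure \<nu>) = sets (restrict_space borel {0..})"
    using sets.sigma_sets_eq[of "restrict_space borel {0::real..}"]
    unfolding expected_radius_measure_def sets_measure_of[OF sub] by (simp add: space_restrict_space)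
qed

text \<open>The set function in the definition of \<^const>\<open>expected_radius_measure\<close> is a measure.\<close>

lemma emeasure_expected_radius_measure:
  assumes \<nu>: "sets \<nu> = sets (all_covers_borel I d)"
    and A: "A \<in> sets (restrict_space borel {0..})"
  shows "emeasure (expected_radius_measure \<nu>) A
           = (\<integral>\<^sup>+(m, \<rho>). of_nat (card {i\<in>{1..m}. \<rho> i \<in> A}) \<partial>\<nu>)"
proof -
  let ?\<mu> = "\<lambda>A. \<integral>\<^sup>+(m, \<rho>). of_nat (card {i\<in>{1..m}. \<rho> i \<in> A}) \<partial>\<nu>"
  let ?S = "sets (restrict_space borel {0::real..})"
  have S: "B \<in> sets borel" if "B \<in> ?S" for B
    using that by (auto simp: sets_restrict_space)
  have ca: "countably_additive ?S ?\<mu>"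
    unfolding countably_additive_def
  proof (intro allI impI)
    fix B :: "nat \<Rightarrow> real set" assume B: "range B \<subseteq> ?S" and disj: "disjoint_family B"
    have meas: "(\<lambda>(m, \<rho>). of_nat (card {i\<in>{1..m}. \<rho> i \<in> B k}) :: ennreal) \<in> borel_measurable \<nu>" for k
      using measurable_radius_count[of "B k" I d] S[of "B k"] B measurable_cong_sets[OF \<nu> refl] by blast
    have count: "(\<Sum>i\<in>{1..m}. indicator X (\<rho> i)) = (of_nat (card {i\<in>{1..m}. \<rho> i \<in> X}) :: ennreal)"
      for m :: nat and \<rho> :: "nat \<Rightarrow> real" and X
      by (simp add: indicator_def sum.If_cases Int_def)
    have pt: "(\<Sum>k. of_nat (card {i\<in>{1..m}. \<rho> i \<in> B k}))
        = (of_nat (card {i\<in>{1..m}. \<rho> i \<in> (\<Union>k. B k)}) :: ennreal)" for m :: nat and \<rho>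
      unfolding count[symmetric]
      by (subst suminf_sum) (auto simp: suminf_indicator[OF disj])
    have "(\<Sum>k. ?\<mu> (B k)) = (\<integral>\<^sup>+x. (\<Sum>k. case x of (m, \<rho>) \<Rightarrow> of_nat (card {i\<in>{1..m}. \<rho> i \<in> B k})) \<partial>\<nu>)"
      by (rule nn_integral_suminf[symmetric]) (rule meas)
    also have "\<dots> = ?\<mu> (\<Union>k. B k)"
      by (simp only: case_prod_unfold pt)
    finally show "(\<Sum>k. ?\<mu> (B k)) = ?\<mu> (\<Union>k. B k)" .
  qed
  show ?thesis
  proof (rule emeasure_measure_of[OF expected_radius_measure_def])
    show "?S \<subseteq> Pow {0..}"
      using sets.space_closed[of "restrict_space borel {0::real..}"] by (simp add: space_restrict_space)
    show "positive (sets (expected_radius_measure \<nu>)) ?\<mu>" by (simp add: positive_def case_prod_unfold)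
    show "countably_additive (sets (expected_radius_measure \<nu>)) ?\<mu>"
      using ca by (simp only: sets_expected_radius_measure)
    show "A \<in> sets (expected_radius_measure \<nu>)"
      using A by (simp only: sets_expected_radius_measure)
  qed
qed

end

theory Submission
  imports Defs
begin

text \<open>
  Two first-moment computations meet. A cover of an interval of length \<open>L\<close> by balls of radii \<open>\<rho> i\<close>
  is a cover by sets of length at most \<open>2 * \<rho> i\<close>, so the radii of every cover sum to at least \<open>L / 2\<close>
  (lemma \<open>sum_radii_of_cover_ge\<close>). On the other hand, the expectation of the sum of the radii is the
  first moment of the expected radius measure (lemma \<open>nn_integral_expected_radius_measure\<close>), and the
  assumed domination bounds it by the first moment of \<open>L / r\<close> times the uniform distribution, which
  is \<open>(L / r) * (r / 2) = L / 2\<close>. Hence both inequalities are equalities.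

  Equality in the bound for covers says that the sum is almost surely \<open>L / 2\<close>. Equality of the two
  first moments forces the two measures to agree: where one measure dominates another and the
  integrals of a positive function coincide, no mass can be missing
  (lemma \<open>measure_eq_if_le_and_nn_integral_eq\<close>). The weight \<open>x\<close> vanishes only at \<open>0\<close>, which
  the uniform distribution does not charge; for the same reason almost surely no radius is \<open>0\<close>.

  The geometry of the third part is deterministic. If the total length \<open>2 * (\<Sum>i. \<rho> i)\<close> is exactly \<open>L\<close>,
  there is no room for waste: a ball reaching beyond an end of the interval would lose length,
  and so would two balls with a common interior point, since they overlap in positive length
  (lemma \<open>tight_metric_interval_cover\<close>).
\<close>

section \<open>Families of sets covering without excess\<close>

text \<open>
  Removing \<open>B j\<close> from \<open>B i\<close> leaves a cover of \<open>A\<close> whose total measure is smaller by the measure of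
  the overlap.
\<close>

lemma null_overlap_if_sum_measure_le:
  assumes fin: "finite J" and B: "\<And>k. k \<in> J \<Longrightarrow> B k \<in> fmeasurable M"
    and A: "A \<in> sets M" "A \<subseteq> (\<Union>k\<in>J. B k)"
    and sum: "(\<Sum>k\<in>J. measure M (B k)) \<le> measure M A"
    and ij: "i \<in> J" "j \<in> J" "i \<noteq> j"
  shows "measure M (B i \<inter> B j) = 0"
proof -
  define C where "C k = (if k = i then B i - B j else B k)" for k
  have Bs: "B k \<in> sets M" if "k \<in> J" for k using B[OF that] by (rule fmeasurableD)
  have C: "C k \<in> fmeasurable M" if "k \<in> J" for k
    using B[OF that] B[OF ij(1)] Bs[OF ij(2)] by (auto simp: C_def intro: fmeasurable_Diff)
  have "A \<subseteq> (\<Union>k\<in>J. C k)"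
    using A(2) ij unfolding C_def by fastforce
  then have "measure M A \<le> measure M (\<Union>k\<in>J. C k)"
    using fin C A(1) by (intro measure_mono_fmeasurable) auto
  also have "\<dots> \<le> (\<Sum>k\<in>J. measure M (C k))"
    using fin C by (intro measure_UNION_le) auto
  also have "\<dots> = measure M (B i - B j) + (\<Sum>k\<in>J - {i}. measure M (B k))"
    using fin ij by (subst sum.remove[of _ i]) (auto simp: C_def intro!: sum.cong)
  finally have "measure M (B i) \<le> measure M (B i - B j)"
    using sum fin ij by (subst (asm) (2) sum.remove[of _ i]) auto
  moreover have "measure M (B i) = measure M (B i \<inter> B j) + measure M (B i - B j)"
  proof -
    have "B i \<inter> B j \<union> B i = B i" "B i - B i \<inter> B j = B i - B j" by auto
    then show ?thesis
      using measure_Un2[of "B i \<inter> B j" M "B i"] B Bs ij by (simp add: fmeasurable_Int_fmeasurable)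
  qed
  ultimately show ?thesis
    by (simp add: antisym)
qed

lemma fmeasurable_lborel_Icc [simp, intro]: "{a..b :: real} \<in> fmeasurable lborel"
  by (intro fmeasurableI) (auto simp: emeasure_lborel_Icc_eq)

lemma measure_clipped_interval_le:
  fixes c \<rho> L :: real
  assumes "0 \<le> \<rho>"
  shows "measure lborel ({0..L} \<inter> {c - \<rho>..c + \<rho>}) \<le> 2 * \<rho>"
proof -
  have "measure lborel ({0..L} \<inter> {c - \<rho>..c + \<rho>}) \<le> measure lborel {c - \<rho>..c + \<rho>}"
    by (intro measure_mono_fmeasurable) auto
  then show ?thesis using assms by simp
qed

lemma sum_radii_ge_half_length:
  fixes c \<rho> :: "'i \<Rightarrow> real"
  assumes "finite J" "\<And>i. i \<in> J \<Longrightarrow> 0 \<le> \<rho> i" "{0..L} \<subseteq> (\<Union>i\<in>J. {c i - \<rho> i..c i + \<rho> i})" "0 \<le> L"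
  shows "L / 2 \<le> sum \<rho> J"
proof -
  have "L = measure lborel {0..L}" using assms(4) by simp
  also have "\<dots> \<le> measure lborel (\<Union>i\<in>J. {c i - \<rho> i..c i + \<rho> i})"
    using assms by (intro measure_mono_fmeasurable) (auto intro!: fmeasurable.finite_UN)
  also have "\<dots> \<le> (\<Sum>i\<in>J. measure lborel {c i - \<rho> i..c i + \<rho> i})"
    using assms by (intro measure_UNION_le) auto
  also have "\<dots> = 2 * sum \<rho> J"
    using assms by (simp add: sum_distrib_left)
  finally show ?thesis by simp
qed

text \<open>
  After clipping to \<open>{0..L}\<close> the intervals still cover, so their total length is still at least \<open>L\<close>,
  which was the total length before; hence clipping shortens none of them.
\<close>

lemma tight_interval_cover:
  fixes c \<rho> :: "'i \<Rightarrow> real"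
  assumes fin: "finite J" and pos: "\<And>i. i \<in> J \<Longrightarrow> 0 < \<rho> i"
    and cov: "{0..L} \<subseteq> (\<Union>i\<in>J. {c i - \<rho> i..c i + \<rho> i})" and L: "0 \<le> L"
    and sum: "sum \<rho> J = L / 2"
  shows "i \<in> J \<Longrightarrow> 0 \<le> c i - \<rho> i \<and> c i + \<rho> i \<le> L"
    and "\<lbrakk>i \<in> J; j \<in> J; i \<noteq> j\<rbrakk> \<Longrightarrow>
           measure lborel ({c i - \<rho> i..c i + \<rho> i} \<inter> {c j - \<rho> j..c j + \<rho> j}) = 0"
proof -
  define T where "T i = {0..L} \<inter> {c i - \<rho> i..c i + \<rho> i}" for i
  have T: "T i \<in> fmeasurable lborel" for i unfolding T_def by (intro fmeasurable_Int_fmeasurable) auto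
  have le: "measure lborel (T i) \<le> 2 * \<rho> i" if "i \<in> J" for i
    using measure_clipped_interval_le[of "\<rho> i"] pos[OF that] by (simp add: T_def)
  have "L = measure lborel {0..L}" using L by simp
  also have "\<dots> \<le> measure lborel (\<Union>i\<in>J. T i)"
  proof (rule measure_mono_fmeasurable)
    show "{0..L} \<subseteq> (\<Union>i\<in>J. T i)" using cov unfolding T_def by blast
  qed (use fin T in \<open>auto intro: fmeasurable.finite_UN\<close>)
  also have "\<dots> \<le> (\<Sum>i\<in>J. measure lborel (T i))"
    using fin T by (intro measure_UNION_le fmeasurableD) auto
  finally have "(\<Sum>i\<in>J. measure lborel (T i)) = (\<Sum>i\<in>J. 2 * \<rho> i)"
    using sum sum_mono[of J "\<lambda>i. measure lborel (T i)" "\<lambda>i. 2 * \<rho> i"] le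
    by (simp add: sum_distrib_left[symmetric])
  from sum_mono_inv[OF this le] fin have eq: "measure lborel (T i) = 2 * \<rho> i" if "i \<in> J" for i
    using that by simp
  show "0 \<le> c i - \<rho> i \<and> c i + \<rho> i \<le> L" if "i \<in> J" for i
    using eq[OF that] pos[OF that] by (auto simp: T_def split: if_splits simp: max_def min_def)
  show "measure lborel ({c i - \<rho> i..c i + \<rho> i} \<inter> {c j - \<rho> j..c j + \<rho> j}) = 0"
    if "i \<in> J" "j \<in> J" "i \<noteq> j" for i j
  proof (rule null_overlap_if_sum_measure_le[OF fin _ _ cov _ that])
    show "(\<Sum>k\<in>J. measure lborel {c k - \<rho> k..c k + \<rho> k}) \<le> measure lborel {0..L}"
    proof -
      have "(\<Sum>k\<in>J. measure lborel {c k - \<rho> k..c k + \<rho> k}) = (\<Sum>k\<in>J. 2 * \<rho> k)"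
        using pos by (intro sum.cong) (auto simp: less_imp_le)
      then show ?thesis using sum L by (simp add: sum_distrib_left[symmetric])
    qed
  qed auto
qed

section \<open>Covers of a metric interval\<close>

text \<open>
  Pulling the centers back along the isometry turns balls of \<open>I\<close> into intervals clipped to \<open>{0..L}\<close>,
  which reduces statements about covers of \<open>I\<close> to the real line.
\<close>

lemma cover_coordinates:
  assumes I: "metric_interval I d L" and cov: "realizes_cover I d m v \<rho>"
  obtains f c where "f ` {0..L} = I"
    and "\<And>s t. s \<in> {0..L} \<Longrightarrow> t \<in> {0..L} \<Longrightarrow> d (f s) (f t) = \<bar>s - t\<bar>"
    and "\<And>i. i \<in> {1..m} \<Longrightarrow>
           Metric_space.mcball I d (v i) (\<rho> i) = f ` ({0..L} \<inter> {c i - \<rho> i..c i + \<rho> i})"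
    and "{0..L} \<subseteq> (\<Union>i\<in>{1..m}. {c i - \<rho> i..c i + \<rho> i})"
proof -
  interpret Metric_space I d using I by (simp add: metric_interval_def)
  obtain f where f: "f ` {0..L} = I"
    and iso: "\<And>s t. s \<in> {0..L} \<Longrightarrow> t \<in> {0..L} \<Longrightarrow> d (f s) (f t) = \<bar>s - t\<bar>"
    using I by (auto simp: metric_interval_def)
  have "\<forall>i\<in>{1..m}. \<exists>x\<in>{0..L}. v i = f x"
    using cov f by (auto simp: realizes_cover_def)
  then obtain c where c: "\<And>i. i \<in> {1..m} \<Longrightarrow> c i \<in> {0..L} \<and> v i = f (c i)"
    by metis
  have mem: "f t \<in> mcball (v i) (\<rho> i) \<longleftrightarrow> t \<in> {c i - \<rho> i..c i + \<rho> i}"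
    if "i \<in> {1..m}" "t \<in> {0..L}" for i t
  proof -
    have "d (v i) (f t) = \<bar>c i - t\<bar>" using c[OF that(1)] iso that(2) by simp
    moreover have "v i \<in> I" "f t \<in> I" using c[OF that(1)] that(2) f by auto
    ultimately show ?thesis by (auto simp: abs_le_iff)
  qed
  have ball: "mcball (v i) (\<rho> i) = f ` ({0..L} \<inter> {c i - \<rho> i..c i + \<rho> i})" if "i \<in> {1..m}" for i
    using mem[OF that] mcball_subset_mspace[of "v i" "\<rho> i"] f by blast
  have "{0..L} \<subseteq> (\<Union>i\<in>{1..m}. {c i - \<rho> i..c i + \<rho> i})"
  proof
    fix t assume t: "t \<in> {0..L}"
    then have "f t \<in> I" using f by auto
    then obtain i where "i \<in> {1..m}" "f t \<in> mcball (v i) (\<rho> i)"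
      using cov unfolding realizes_cover_def by blast
    then show "t \<in> (\<Union>i\<in>{1..m}. {c i - \<rho> i..c i + \<rho> i})" using mem t by blast
  qed
  with f iso ball show thesis by (rule that)
qed

lemma metric_interval_image:
  assumes "Metric_space I d" "f ` {a..b} \<subseteq> I" "a \<le> b"
    and iso: "\<And>s t. s \<in> {a..b} \<Longrightarrow> t \<in> {a..b} \<Longrightarrow> d (f s) (f t) = \<bar>s - t\<bar>"
  shows "metric_interval (f ` {a..b}) d (b - a)"
proof -
  have "(\<lambda>t. f (a + t)) ` {0..b - a} = f ` {a..b}"
  proof -
    have "(\<lambda>t. f (a + t)) ` {0..b - a} = f ` ((+) a ` {0..b - a})" by (simp only: image_image)
    then show ?thesis by simp
  qed
  then show ?thesis
    using assms unfolding metric_interval_def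
    by (intro conjI exI[of _ "\<lambda>t. f (a + t)"]) (auto intro: Metric_space.subspace)
qed

text \<open>
  An interior point common to two balls has a neighbourhood in both. In coordinates this
  neighbourhood contains an interval of positive length, even when the point is an end of \<open>I\<close>, while
  the overlap of the two balls is a null set.
\<close>

lemma tight_metric_interval_cover:
  assumes I: "metric_interval I d L"
    and pos: "\<forall>i\<in>{1..m}. \<rho> i > 0" and sum: "(\<Sum>i=1..m. \<rho> i) = L / 2"
    and cov: "realizes_cover I d m v \<rho>"
  shows "\<lbrakk>i \<in> {1..m}; j \<in> {1..m}; i \<noteq> j\<rbrakk> \<Longrightarrow>
           disjnt (Metric_space.mtopology I d interior_of Metric_space.mcball I d (v i) (\<rho> i))
                  (Metric_space.mtopology I d interior_of Metric_space.mcball I d (v j) (\<rho> j))"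
    and "i \<in> {1..m} \<Longrightarrow> metric_interval (Metric_space.mcball I d (v i) (\<rho> i)) d (2 * \<rho> i)"
    and "(\<Union>i\<in>{1..m}. Metric_space.mcball I d (v i) (\<rho> i)) = I"
proof -
  interpret Metric_space I d using I by (simp add: metric_interval_def)
  have L: "0 \<le> L" using I by (simp add: metric_interval_def)
  obtain f c where f: "f ` {0..L} = I"
    and iso: "\<And>s t. s \<in> {0..L} \<Longrightarrow> t \<in> {0..L} \<Longrightarrow> d (f s) (f t) = \<bar>s - t\<bar>"
    and ball: "\<And>i. i \<in> {1..m} \<Longrightarrow> mcball (v i) (\<rho> i) = f ` ({0..L} \<inter> {c i - \<rho> i..c i + \<rho> i})"
    and cov': "{0..L} \<subseteq> (\<Union>i\<in>{1..m}. {c i - \<rho> i..c i + \<rho> i})"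
    by (rule cover_coordinates[OF I cov]) (rule that)
  have inside: "0 \<le> c i - \<rho> i \<and> c i + \<rho> i \<le> L" if "i \<in> {1..m}" for i
    using tight_interval_cover(1)[OF _ _ cov' L sum that] pos by blast
  have overlap: "measure lborel ({c i - \<rho> i..c i + \<rho> i} \<inter> {c j - \<rho> j..c j + \<rho> j}) = 0"
    if "i \<in> {1..m}" "j \<in> {1..m}" "i \<noteq> j" for i j
    using tight_interval_cover(2)[OF _ _ cov' L sum that] pos by blast
  have ball': "mcball (v i) (\<rho> i) = f ` {c i - \<rho> i..c i + \<rho> i}" if "i \<in> {1..m}" for i
    using ball[OF that] inside[OF that] by (auto simp: Int_absorb1)
  show "metric_interval (mcball (v i) (\<rho> i)) d (2 * \<rho> i)" if i: "i \<in> {1..m}"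
  proof -
    have "metric_interval (f ` {c i - \<rho> i..c i + \<rho> i}) d ((c i + \<rho> i) - (c i - \<rho> i))"
      using inside[OF i] pos i f iso by (intro metric_interval_image[OF Metric_space_axioms]) (auto simp: less_imp_le)
    then show ?thesis by (simp add: ball'[OF i])
  qed
  show "(\<Union>i\<in>{1..m}. mcball (v i) (\<rho> i)) = I"
    using cov mcball_subset_mspace by (auto simp: realizes_cover_def)
  have inj: "inj_on f {0..L}"
  proof (rule inj_onI)
    fix s t assume "s \<in> {0..L}" "t \<in> {0..L}" "f s = f t"
    with iso[of s t] iso[of t t] show "s = t" by simp
  qed
  show "disjnt (mtopology interior_of mcball (v i) (\<rho> i)) (mtopology interior_of mcball (v j) (\<rho> j))"
    if i: "i \<in> {1..m}" and j: "j \<in> {1..m}" and "i \<noteq> j"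
  proof (rule ccontr)
    assume "\<not> disjnt (mtopology interior_of mcball (v i) (\<rho> i)) (mtopology interior_of mcball (v j) (\<rho> j))"
    then obtain p where p: "p \<in> mtopology interior_of (mcball (v i) (\<rho> i) \<inter> mcball (v j) (\<rho> j))"
      by (auto simp: disjnt_iff interior_of_Int)
    then obtain U where "openin mtopology U" "p \<in> U" "U \<subseteq> mcball (v i) (\<rho> i) \<inter> mcball (v j) (\<rho> j)"
      by (auto simp: interior_of_def)
    then obtain e where "e > 0" and e: "mball p e \<subseteq> mcball (v i) (\<rho> i) \<inter> mcball (v j) (\<rho> j)"
      unfolding openin_mtopology by blast
    have "p \<in> I" using p interior_of_subset_topspace by fastforce
    then obtain s where s: "s \<in> {0..L}" "p = f s" using f by auto
    \<comment> \<open>Clipping to \<open>{0..L}\<close> leaves a positive length even if \<open>s\<close> is \<open>0\<close> or \<open>L\<close>.\<close>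
    define a b where "a = max 0 (s - e / 2)" and "b = min L (s + e / 2)"
    have "0 < L" using pos inside i by fastforce
    then have "a < b" using s \<open>e > 0\<close> by (auto simp: a_def b_def)
    have "{a..b} \<subseteq> {c i - \<rho> i..c i + \<rho> i} \<inter> {c j - \<rho> j..c j + \<rho> j}"
    proof
      fix t assume t: "t \<in> {a..b}"
      then have tL: "t \<in> {0..L}" by (auto simp: a_def b_def)
      have "\<bar>s - t\<bar> < e" using t \<open>e > 0\<close> by (auto simp: a_def b_def abs_less_iff)
      then have "f t \<in> mball p e" using s iso[OF s(1) tL] tL f by auto
      with e have ft: "f t \<in> f ` {c i - \<rho> i..c i + \<rho> i}" "f t \<in> f ` {c j - \<rho> j..c j + \<rho> j}"
        using ball' i j by blast+
      have "t \<in> {c k - \<rho> k..c k + \<rho> k}" if "f t \<in> f ` {c k - \<rho> k..c k + \<rho> k}" "k \<in> {1..m}" for k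
      proof -
        have "{c k - \<rho> k..c k + \<rho> k} \<subseteq> {0..L}" using inside[OF that(2)] by auto
        then show ?thesis using that(1) tL inj by (simp add: inj_on_image_mem_iff)
      qed
      with ft i j show "t \<in> {c i - \<rho> i..c i + \<rho> i} \<inter> {c j - \<rho> j..c j + \<rho> j}" by blast
    qed
    then have "measure lborel {a..b}
        \<le> measure lborel ({c i - \<rho> i..c i + \<rho> i} \<inter> {c j - \<rho> j..c j + \<rho> j})"
      by (intro measure_mono_fmeasurable fmeasurable_Int_fmeasurable) auto
    with overlap[OF i j \<open>i \<noteq> j\<close>] \<open>a < b\<close> show False by simp
  qed
qed

lemma cover_radius_nonneg:
  assumes "\<rho> \<in> covers I d m" "i \<in> {1..m}"
  shows "0 \<le> \<rho> i"
proof -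
  have "\<rho> \<in> {1..m} \<rightarrow>\<^sub>E {0..}" using assms(1) unfolding covers_def by blast
  from PiE_mem[OF this assms(2)] show ?thesis by simp
qed

lemma sum_radii_of_cover_ge:
  assumes I: "metric_interval I d L" and \<rho>: "\<rho> \<in> covers I d m"
  shows "L / 2 \<le> (\<Sum>i=1..m. \<rho> i)"
proof -
  obtain v where v: "realizes_cover I d m v \<rho>" using \<rho> unfolding covers_def by blast
  show ?thesis
  proof (rule cover_coordinates[OF I v])
    fix f :: "real \<Rightarrow> 'a" and c
    assume "{0..L} \<subseteq> (\<Union>i\<in>{1..m}. {c i - \<rho> i..c i + \<rho> i})"
    moreover have "0 \<le> L" using I unfolding metric_interval_def by blast
    ultimately show ?thesis
      using cover_radius_nonneg[OF \<rho>] by (intro sum_radii_ge_half_length) blast+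
  qed
qed

section \<open>The expected radius measure\<close>

text \<open>
  Integrals of \<open>w\<close> over \<open>A\<close> and over its complement are each monotone in the measure, and their sums
  agree and are finite, so they agree separately. Thus \<open>M\<close> and \<open>N\<close> become the same measure when multiplied
  by the density \<open>w\<close>, and dividing by \<open>w\<close> recovers them.
\<close>

lemma measure_eq_if_le_and_nn_integral_eq:
  assumes sets: "sets M = sets N" and le: "M \<le> N"
    and w[measurable]: "w \<in> borel_measurable N"
    and w_pos: "AE x in N. 0 < w x \<and> w x < (\<infinity>::ennreal)"
    and eq: "(\<integral>\<^sup>+x. w x \<partial>M) = (\<integral>\<^sup>+x. w x \<partial>N)" and fin: "(\<integral>\<^sup>+x. w x \<partial>N) < \<infinity>"
  shows "M = N"
proof -
  have [measurable_cong]: "sets M = sets N" by fact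
  have mono: "(\<integral>\<^sup>+x. f x \<partial>M) \<le> (\<integral>\<^sup>+x. f x \<partial>N)" for f
    using sets le by (rule nn_integral_mono_measure)
  have w_eq: "density M w = density N w"
  proof (rule measure_eqI)
    fix A assume "A \<in> sets (density M w)"
    then have A[measurable]: "A \<in> sets N" by (simp add: sets)
    have split: "(\<integral>\<^sup>+x. w x \<partial>K) = (\<integral>\<^sup>+x\<in>space N - A. w x \<partial>K) + (\<integral>\<^sup>+x\<in>A. w x \<partial>K)"
      if [measurable_cong]: "sets K = sets N" for K
      using sets_eq_imp_space_eq[OF that]
      by (subst nn_integral_add[symmetric])
        (auto intro!: nn_integral_cong split: split_indicator)
    have "(\<integral>\<^sup>+x\<in>space N - A. w x \<partial>N) + (\<integral>\<^sup>+x\<in>A. w x \<partial>N)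
        = (\<integral>\<^sup>+x\<in>space N - A. w x \<partial>M) + (\<integral>\<^sup>+x\<in>A. w x \<partial>M)"
      using eq split[OF sets] split[OF refl] by simp
    also have "\<dots> \<le> (\<integral>\<^sup>+x\<in>space N - A. w x \<partial>N) + (\<integral>\<^sup>+x\<in>A. w x \<partial>M)"
      by (intro add_right_mono mono)
    finally have "(\<integral>\<^sup>+x\<in>A. w x \<partial>N) \<le> (\<integral>\<^sup>+x\<in>A. w x \<partial>M)"
      using fin unfolding split[OF refl] by (auto simp: ennreal_add_left_cancel_le)
    then have "(\<integral>\<^sup>+x\<in>A. w x \<partial>M) = (\<integral>\<^sup>+x\<in>A. w x \<partial>N)"
      by (intro antisym mono)
    then show "emeasure (density M w) A = emeasure (density N w) A"
      by (simp add: emeasure_density)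
  qed (simp add: sets)
  have recover: "K = density (density K w) (\<lambda>x. 1 / w x)"
    if [measurable_cong]: "sets K = sets N" and ae: "AE x in K. 0 < w x \<and> w x < (\<infinity>::ennreal)" for K
  proof -
    have "density (density K w) (\<lambda>x. 1 / w x) = density K (\<lambda>x. w x * (1 / w x))"
      by (rule density_density_eq) measurable
    also have "\<dots> = density K (\<lambda>_. 1)"
    proof (rule density_cong)
      show "AE x in K. w x * (1 / w x) = 1"
        using ae by eventually_elim (auto simp: ennreal_times_divide zero_less_iff_neq_zero)
    qed measurable
    finally show ?thesis by (simp add: density_1)
  qed
  have "AE x in M. 0 < w x \<and> w x < (\<infinity>::ennreal)"
  proof -
    have "emeasure M Z \<le> emeasure N Z" for Z using le sets by (rule le_measureD3)
    then have "absolutely_continuous N M"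
      using sets unfolding absolutely_continuous_def null_sets_def
      by (auto simp flip: le_zero_eq intro: order_trans)
    from absolutely_continuous_AE[OF sets this w_pos] show ?thesis .
  qed
  with recover[OF sets] recover[OF refl w_pos] w_eq show ?thesis by simp
qed

text \<open>
  Campbell's formula. On indicators it is the definition of the expected radius measure, and both sides
  are linear and continuous along increasing sequences. Measurability is proved in the same induction
  because the steps for sums and suprema need it.
\<close>

lemma
  assumes sets: "sets \<nu> = sets (all_covers_borel I d)"
    and f: "f \<in> borel_measurable (restrict_space borel {0..})"
  shows measurable_radius_sum: "(\<lambda>(m, \<rho>). \<Sum>i=1..m. f (\<rho> i)) \<in> borel_measurable \<nu>" (is ?m)
    and nn_integral_expected_radius_measure:
      "(\<integral>\<^sup>+x. f x \<partial>expected_radius_measure \<nu>) = (\<integral>\<^sup>+(m, \<rho>). (\<Sum>i=1..m. f (\<rho> i)) \<partial>\<nu>)" (is ?i)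
proof -
  have [measurable_cong]: "sets (expected_radius_measure \<nu>) = sets (restrict_space borel {0..})"
    by (rule sets_expected_radius_measure)
  have nn: "0 \<le> \<rho> i" if "(m, \<rho>) \<in> space \<nu>" "i \<in> {1..m}" for m \<rho> i
  proof (rule cover_radius_nonneg[OF _ that(2)])
    show "\<rho> \<in> covers I d m"
      using that(1) unfolding sets_eq_imp_space_eq[OF sets] space_all_covers_borel
      by (auto simp: all_covers_def)
  qed
  have "?m \<and> ?i" using f
  proof (induction f rule: borel_measurable_induct)
    case (cong f g)
    have "(\<Sum>i=1..m. f (\<rho> i)) = (\<Sum>i=1..m. g (\<rho> i))" if "(m, \<rho>) \<in> space \<nu>" for m \<rho>
      using cong(3) nn[OF that] by (intro sum.cong) (auto simp: space_restrict_space)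
    then have eq: "(\<lambda>(m, \<rho>). \<Sum>i=1..m. f (\<rho> i)) x = (\<lambda>(m, \<rho>). \<Sum>i=1..m. g (\<rho> i)) x"
      if "x \<in> space \<nu>" for x using that by (cases x) auto
    have "(\<integral>\<^sup>+x. f x \<partial>expected_radius_measure \<nu>) = (\<integral>\<^sup>+x. g x \<partial>expected_radius_measure \<nu>)"
      using cong(3) by (intro nn_integral_cong) (auto simp: space_expected_radius_measure space_restrict_space)
    with cong(4) show ?case
      using measurable_cong[of \<nu>, OF eq] nn_integral_cong[of \<nu>, OF eq] by simp
  next
    case (set A)
    then have A: "A \<in> sets borel" by (auto simp: sets_restrict_space)
    have count: "(\<Sum>i\<in>{1..m}. indicator A (\<rho> i)) = (of_nat (card {i\<in>{1..m}. \<rho> i \<in> A}) :: ennreal)"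
      for m :: nat and \<rho> :: "nat \<Rightarrow> real"
      by (simp add: indicator_def sum.If_cases Int_def)
    have "(\<lambda>(m, \<rho>). of_nat (card {i\<in>{1..m}. \<rho> i \<in> A}) :: ennreal) \<in> borel_measurable \<nu>"
      using measurable_radius_count[OF A, of I d] measurable_cong_sets[OF sets refl] by blast
    moreover have "(\<integral>\<^sup>+x. indicator A x \<partial>expected_radius_measure \<nu>)
        = (\<integral>\<^sup>+(m, \<rho>). of_nat (card {i\<in>{1..m}. \<rho> i \<in> A}) \<partial>\<nu>)"
      using set by (subst nn_integral_indicator)
        (simp_all only: sets_expected_radius_measure emeasure_expected_radius_measure[OF sets])
    ultimately show ?case unfolding count ..
  next
    case (mult u c)
    then have [measurable]: "(\<lambda>(m, \<rho>). \<Sum>i=1..m. u (\<rho> i)) \<in> borel_measurable \<nu>" by simp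
    have eq: "(\<lambda>(m, \<rho>). \<Sum>i=1..m. c * u (\<rho> i)) = (\<lambda>x. c * (\<lambda>(m, \<rho>). \<Sum>i=1..m. u (\<rho> i)) x)"
      by (auto simp: sum_distrib_left)
    show ?case
      unfolding eq using mult
      by (simp add: nn_integral_cmult measurable_cong_sets[OF sets_expected_radius_measure refl]
          del: One_nat_def)
  next
    case (add u v)
    then have [measurable]: "(\<lambda>(m, \<rho>). \<Sum>i=1..m. u (\<rho> i)) \<in> borel_measurable \<nu>"
      "(\<lambda>(m, \<rho>). \<Sum>i=1..m. v (\<rho> i)) \<in> borel_measurable \<nu>" by simp_all
    have eq: "(\<lambda>(m, \<rho>). \<Sum>i=1..m. v (\<rho> i) + u (\<rho> i))
        = (\<lambda>x. (\<lambda>(m, \<rho>). \<Sum>i=1..m. v (\<rho> i)) x + (\<lambda>(m, \<rho>). \<Sum>i=1..m. u (\<rho> i)) x)"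
      by (auto simp: sum.distrib)
    show ?case
      unfolding eq using add
      by (simp add: nn_integral_add measurable_cong_sets[OF sets_expected_radius_measure refl]
          del: One_nat_def)
  next
    case (seq U)
    have meas: "(\<lambda>(m, \<rho>). \<Sum>i=1..m. U k (\<rho> i)) \<in> borel_measurable \<nu>" for k
      using seq.IH[of k] by (rule conjunct1)
    have inc: "incseq (\<lambda>k. U k x)" for x using seq(3) by (auto simp: incseq_def le_fun_def)
    have eq: "(\<lambda>(m, \<rho>). \<Sum>i=1..m. (SUP k. U k) (\<rho> i))
        = (\<lambda>x. SUP k. (\<lambda>(m, \<rho>). \<Sum>i=1..m. U k (\<rho> i)) x)"
      using inc by (auto simp: fun_eq_iff image_comp ennreal_SUP_sum)
    have inc': "incseq (\<lambda>k. (\<lambda>(m, \<rho>). \<Sum>i=1..m. U k (\<rho> i)))"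
      using seq(3) by (auto simp: incseq_def le_fun_def intro!: sum_mono)
    have "(\<integral>\<^sup>+x. (SUP k. U k) x \<partial>expected_radius_measure \<nu>)
        = (SUP k. \<integral>\<^sup>+x. U k x \<partial>expected_radius_measure \<nu>)"
      unfolding SUP_apply using seq(1,3)
      by (intro nn_integral_monotone_convergence_SUP)
        (simp_all add: measurable_cong_sets[OF sets_expected_radius_measure refl])
    also have "\<dots> = (SUP k. \<integral>\<^sup>+(m, \<rho>). (\<Sum>i=1..m. U k (\<rho> i)) \<partial>\<nu>)"
      using seq.IH by (intro SUP_cong refl) (rule conjunct2)
    also have "\<dots> = (\<integral>\<^sup>+(m, \<rho>). (\<Sum>i=1..m. (SUP k. U k) (\<rho> i)) \<partial>\<nu>)"
      unfolding eq using inc' by (intro nn_integral_monotone_convergence_SUP[symmetric] meas)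
    finally have "(\<integral>\<^sup>+x. (SUP k. U k) x \<partial>expected_radius_measure \<nu>)
        = (\<integral>\<^sup>+(m, \<rho>). (\<Sum>i=1..m. (SUP k. U k) (\<rho> i)) \<partial>\<nu>)" .
    moreover have "(\<lambda>(m, \<rho>). \<Sum>i=1..m. (SUP k. U k) (\<rho> i)) \<in> borel_measurable \<nu>"
      unfolding eq by (intro borel_measurable_SUP meas) auto
    ultimately show ?case by (rule conjI[rotated])
  qed
  then show ?m ?i by auto
qed

lemma emeasure_scaled_uniform:
  assumes "r > 0" "A \<in> sets (restrict_space borel {0..})"
  shows "emeasure (scale_measure (ennreal (L / r)) (uniform_radius_measure r)) A
     = ennreal (L / r) * (emeasure lborel ({0..r} \<inter> A) / ennreal r)"
  using assms by (subst (asm) sets_restrict_space_iff)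
   (auto simp: uniform_radius_measure_def emeasure_restrict_space space_restrict_space)

lemma nn_integral_scaled_uniform:
  assumes "r > 0" "L > 0"
  shows "(\<integral>\<^sup>+x. ennreal x \<partial>scale_measure (ennreal (L / r)) (uniform_radius_measure r)) = ennreal (L / 2)"
proof -
  have "(\<integral>\<^sup>+x. ennreal x * indicator {0..r} x \<partial>lborel) = ennreal (r\<^sup>2 / 2 - 0\<^sup>2 / 2)"
    using assms by (intro nn_integral_FTC_Icc) (auto intro!: derivative_eq_intros)
  then have "(\<integral>\<^sup>+x. ennreal x \<partial>uniform_radius_measure r) = ennreal (r\<^sup>2 / 2) / ennreal r"
    using assms unfolding uniform_radius_measure_def
    by (subst nn_integral_restrict_space)
      (auto simp: nn_integral_uniform_measure indicator_inter_arith[symmetric] mult.assoc Int_absorb1)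
  also have "\<dots> = ennreal (r / 2)"
    using assms by (simp add: divide_ennreal power2_eq_square)
  finally have "(\<integral>\<^sup>+x. ennreal x \<partial>uniform_radius_measure r) = ennreal (r / 2)" .
  moreover have "(\<lambda>x. ennreal x) \<in> borel_measurable (uniform_radius_measure r)"
    unfolding uniform_radius_measure_def by (intro measurable_restrict_space1) measurable
  ultimately show ?thesis
    using assms by (simp add: nn_integral_scale_measure ennreal_mult[symmetric])
qed

theorem theorem5p13:
  fixes I :: "'a set" and d :: "'a \<Rightarrow> 'a \<Rightarrow> real" and L r :: real
    and \<nu> :: "(nat \<times> (nat \<Rightarrow> real)) measure"
  assumes "metric_interval I d L" and "L > 0" and "r > 0"
    and "prob_space \<nu>" and "sets \<nu> = sets (all_covers_borel I d)"
    and "\<forall>A\<in>sets (restrict_space borel {0..}).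
           emeasure (expected_radius_measure \<nu>) A
             \<le> emeasure (scale_measure (ennreal (L / r)) (uniform_radius_measure r)) A"
  shows "expected_radius_measure \<nu> = scale_measure (ennreal (L / r)) (uniform_radius_measure r)
    \<and> (AE (m, \<rho>) in \<nu>. (\<forall>i\<in>{1..m}. \<rho> i > 0) \<and> (\<Sum>i=1..m. \<rho> i) = L / 2)
    \<and> (AE (m, \<rho>) in \<nu>.
         (\<forall>i\<in>{1..m}. \<rho> i > 0) \<and> (\<Sum>i=1..m. \<rho> i) = L / 2 \<longrightarrow>
         (\<forall>v. realizes_cover I d m v \<rho> \<longrightarrow>
            (\<forall>i\<in>{1..m}. \<forall>j\<in>{1..m}. i \<noteq> j \<longrightarrow>
               disjnt (Metric_space.mtopology I d interior_of Metric_space.mcball I d (v i) (\<rho> i))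
                      (Metric_space.mtopology I d interior_of Metric_space.mcball I d (v j) (\<rho> j)))
          \<and> (\<forall>i\<in>{1..m}. metric_interval (Metric_space.mcball I d (v i) (\<rho> i)) d (2 * \<rho> i))
          \<and> (\<Union>i\<in>{1..m}. Metric_space.mcball I d (v i) (\<rho> i)) = I))"
proof -
  define M where "M = scale_measure (ennreal (L / r)) (uniform_radius_measure r)"
  define E where "E = expected_radius_measure \<nu>"
  interpret prob_space \<nu> by fact
  note I = assms(1) and L = assms(2) and r = assms(3) and sets = assms(5)
  have sM: "sets M = sets (restrict_space borel {0..})"
    by (simp add: M_def uniform_radius_measure_def sets_restrict_space)
  have sE: "sets E = sets M"
    by (simp add: sM E_def sets_expected_radius_measure)
  have "E \<le> M"
    unfolding le_measure[OF sE] using assms(6)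
    by (auto simp: le_fun_def E_def M_def sets_expected_radius_measure emeasure_notin_sets)
  have id: "(\<lambda>x. ennreal x) \<in> borel_measurable (restrict_space borel {0..})"
    by (intro measurable_restrict_space1) measurable
  have IM: "(\<integral>\<^sup>+x. ennreal x \<partial>M) = ennreal (L / 2)"
    unfolding M_def by (rule nn_integral_scaled_uniform[OF r L])

  have cover: "\<rho> \<in> covers I d m" if "(m, \<rho>) \<in> space \<nu>" for m \<rho>
    using that unfolding sets_eq_imp_space_eq[OF sets] space_all_covers_borel
    by (auto simp: all_covers_def)
  have nn: "0 \<le> \<rho> i" if "(m, \<rho>) \<in> space \<nu>" "i \<in> {1..m}" for m \<rho> i
    using cover_radius_nonneg[OF cover[OF that(1)] that(2)] .
  define S where "S = (\<lambda>(m :: nat, \<rho> :: nat \<Rightarrow> real). \<Sum>i=1..m. ennreal (\<rho> i))"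
  have S: "S (m, \<rho>) = ennreal (\<Sum>i=1..m. \<rho> i)" if "(m, \<rho>) \<in> space \<nu>" for m \<rho>
    unfolding S_def prod.case by (rule sum_ennreal) (rule nn[OF that])
  have S_meas[measurable]: "S \<in> borel_measurable \<nu>"
    unfolding S_def by (rule measurable_radius_sum[OF sets id])
  have S_ge: "ennreal (L / 2) \<le> S x" if "x \<in> space \<nu>" for x
    using that S sum_radii_of_cover_ge[OF I cover] by (cases x) (simp add: ennreal_leI)
  have IE: "(\<integral>\<^sup>+x. S x \<partial>\<nu>) = (\<integral>\<^sup>+x. ennreal x \<partial>E)"
    unfolding S_def E_def by (rule nn_integral_expected_radius_measure[OF sets id, symmetric])
  have "(\<integral>\<^sup>+x. ennreal (L / 2) \<partial>\<nu>) \<le> (\<integral>\<^sup>+x. S x \<partial>\<nu>)"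
    using S_ge by (rule nn_integral_mono)
  moreover have "(\<integral>\<^sup>+x. ennreal x \<partial>E) \<le> (\<integral>\<^sup>+x. ennreal x \<partial>M)"
    using sE \<open>E \<le> M\<close> by (rule nn_integral_mono_measure)
  ultimately have IS: "(\<integral>\<^sup>+x. S x \<partial>\<nu>) = ennreal (L / 2)"
    using IE IM by (simp add: emeasure_space_1)

  have "emeasure M {0} = 0"
  proof -
    have "emeasure lborel ({0..r} \<inter> {0}) = 0" using r by simp
    then show ?thesis unfolding M_def using r L
      by (subst emeasure_scaled_uniform) (auto simp: sets_restrict_space_iff)
  qed
  then have "AE x in M. x \<noteq> 0"
    by (intro AE_I'[of "{0}"]) (auto simp: null_sets_def sM sets_restrict_space_iff)
  moreover have "AE x in M. 0 \<le> x"
    using sets_eq_imp_space_eq[OF sM] by (intro AE_I2) (simp add: space_restrict_space)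
  ultimately have pos: "AE x in M. 0 < ennreal x \<and> ennreal x < \<infinity>"
    by eventually_elim simp
  have EM: "E = M"
    using sE \<open>E \<le> M\<close> _ pos
  proof (rule measure_eq_if_le_and_nn_integral_eq)
    show "(\<lambda>x. ennreal x) \<in> borel_measurable M" using id by (simp add: measurable_cong_sets[OF sM refl])
    show "(\<integral>\<^sup>+x. ennreal x \<partial>M) < \<infinity>" unfolding IM by simp
  qed (use IE IM IS in simp)

  have "AE x in \<nu>. S x = ennreal (L / 2)"
  proof -
    have "(\<integral>\<^sup>+x. S x - ennreal (L / 2) \<partial>\<nu>) = 0"
      using S_ge IS by (subst nn_integral_diff) (auto simp: emeasure_space_1)
    then have "AE x in \<nu>. S x - ennreal (L / 2) = 0"
      by (subst (asm) nn_integral_0_iff_AE) auto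
    with AE_space show ?thesis
      by eventually_elim (use S_ge in \<open>auto simp: diff_eq_0_iff_ennreal intro: antisym\<close>)
  qed
  \<comment> \<open>The mass of \<open>{0}\<close> under \<open>E\<close> is the expected number of vanishing radii.\<close>
  moreover have "AE x in \<nu>. (case x of (m, \<rho>) \<Rightarrow> of_nat (card {i\<in>{1..m}. \<rho> i \<in> {0}})) = (0::ennreal)"
  proof -
    have "(\<lambda>(m, \<rho>). of_nat (card {i\<in>{1..m}. \<rho> i \<in> {0}}) :: ennreal) \<in> borel_measurable \<nu>"
      by (rule measurable_cong_sets[OF sets refl, THEN equalityD2, THEN subsetD, OF measurable_radius_count]) simp
    note iff = nn_integral_0_iff_AE[OF this]
    have "{0} \<in> sets (restrict_space borel {0::real..})" by (simp add: sets_restrict_space_iff)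
    from emeasure_expected_radius_measure[OF sets this] show ?thesis
      using \<open>emeasure M {0} = 0\<close> unfolding iff[symmetric] EM[symmetric] E_def by (rule trans[OF sym])
  qed
  ultimately have ii: "AE (m, \<rho>) in \<nu>. (\<forall>i\<in>{1..m}. \<rho> i > 0) \<and> (\<Sum>i=1..m. \<rho> i) = L / 2"
    using AE_space
  proof eventually_elim
    case (elim x)
    obtain m \<rho> where x: "x = (m, \<rho>)" by (cases x)
    have "ennreal (\<Sum>i=1..m. \<rho> i) = ennreal (L / 2)"
      using elim(1,3) S[of m \<rho>] by (simp add: x)
    moreover have "0 \<le> (\<Sum>i=1..m. \<rho> i)"
      using elim(3) nn[of m \<rho>] unfolding x by (intro sum_nonneg) blast
    ultimately have "(\<Sum>i=1..m. \<rho> i) = L / 2"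
      using L by (subst (asm) ennreal_inj) auto
    moreover have "{i\<in>{1..m}. \<rho> i = 0} = {}" using elim(2) by (simp add: x)
    then have "\<rho> i > 0" if "i \<in> {1..m}" for i
      using nn[of m \<rho> i] elim(3) that unfolding x by (force simp: less_le)
    ultimately show ?case by (simp add: x)
  qed
  show ?thesis
  proof (intro conjI)
    show "expected_radius_measure \<nu> = scale_measure (ennreal (L / r)) (uniform_radius_measure r)"
      using EM by (simp add: E_def M_def)
    show "AE (m, \<rho>) in \<nu>. (\<forall>i\<in>{1..m}. \<rho> i > 0) \<and> (\<Sum>i=1..m. \<rho> i) = L / 2" by (rule ii)
  qed (rule AE_I2, unfold split_beta,
      (intro impI allI conjI ballI; elim conjE; rule tight_metric_interval_cover[OF I]; assumption))
qed

end
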